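(* Let $y_1,\ldots,y_m\in\mathbb{R}$ be distinct support nodes, $x_1,\ldots,x_n\in\mathbb{R}$ distinct test nodes with $n>m-1$ (test nodes are allowed to coincide with support nodes), and let $\mu_1,\ldots,\mu_n>0$ be weights. Let $S_F=\operatorname{diag}(\mathrm{e}^{\mathrm{i}x_1},\ldots,\mathrm{e}^{\mathrm{i}x_n})\in\mathbb{C}^{n\times n}$ and let $M=S_\mu C'\in\mathbb{R}^{n\times m}$, where $S_\mu=\operatorname{diag}(\mu_1^{1/2},\ldots,\mu_n^{1/2})$ and $C'$ is the modified Cauchy matrix of the nodes. Assume that the smallest singular value of the matrix $[M\,|\,-S_FM]\in\mathbb{C}^{n\times 2m}$ is non-degenerate, and let $\gamma=[\alpha;\beta]\in\mathbb{C}^{2m}$ with $\alpha,\beta\in\mathbb{C}^m$ satisfy $\|\gamma\|_2=1$ and $$\big\|[M\,|\,-S_FM]\gamma\big\|_2=\min_{v\in\mathbb{C}^{2m},\ \|v\|_2=1}\big\|[M\,|\,-S_FM]v\big\|_2 .$$ Assume that the generated barycentric rational approximant $$r_b(x)=\sum_{j=1}^m\frac{\alpha_j}{x-y_j}\Big/\sum_{j=1}^m\frac{\beta_j}{x-y_j}$$ is irreducible. Then $r_b$ has no poles on the real axis and satisfies $|r_b(x)|=1$ for all $x\in\mathbb{R}$.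
   Context: The modified Cauchy matrix $C'\in\mathbb{R}^{n\times m}$ is defined row by row: if $x_k\notin\{y_1,\ldots,y_m\}$, then $C'_{kj}=1/(x_k-y_j)$ for $j=1,\ldots,m$; if $x_k=y_{j_k}$ for some index $j_k$, then $C'_{kj}=1$ for $j=j_k$ and $C'_{kj}=0$ for $j\ne j_k$. The notation $[M\,|\,-S_FM]$ denotes the horizontal concatenation of the two $n\times m$ matrices, and $[\alpha;\beta]$ denotes vertical concatenation. The singular values $\sigma_1\ge\cdots\ge\sigma_{2m}\ge0$ of the $n\times 2m$ matrix $X=[M\,|\,-S_FM]$ are the $2m$ square roots of the eigenvalues of $X^*X$, counted with multiplicity; the smallest one is non-degenerate if $\sigma_{2m-1}>\sigma_{2m}$. Multiplying numerator and denominator by $\prod_{j=1}^m(x-y_j)$, $r_b$ is identified with the rational function $r_b=p/q$, where $$p(x)=\sum_{j=1}^m \alpha_j\prod_{k\ne j}(x-y_k),\qquad q(x)=\sum_{j=1}^m \beta_j\prod_{k\neq j}(x-y_k)$$ are polynomials of degree $\le m-1$; values at the support nodes are understood via $p/q$. The function $r_b$ is called irreducible if $p$ and $q$ have no common (complex) zeros, and the poles of $r_b$ are the zeros of $q$. *)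

theory Defs
  imports
    "HOL-Computational_Algebra.Fundamental_Theorem_Algebra"
    "Jordan_Normal_Form.Schur_Decomposition"
begin

definition l2_norm :: "complex vec \<Rightarrow> real" where
  "l2_norm v = sqrt (\<Sum>i<dim_vec v. (cmod (v $ i))\<^sup>2)"

definition hconcat :: "'a :: zero mat \<Rightarrow> 'a mat \<Rightarrow> 'a mat" where
  "hconcat A B = four_block_mat A B (0\<^sub>m 0 (dim_col A)) (0\<^sub>m 0 (dim_col B))"

(* The eigenvalues of X* X are real and nonnegative, so taking the real part loses nothing.
   The roots of the characteristic polynomial form a multiset; the list is in
   decreasing order, with sigma_k at position k - 1. *)
definition singular_values :: "complex mat \<Rightarrow> real list" where
  "singular_values X =
     rev (sorted_list_of_multiset
       (image_mset (\<lambda>z. sqrt (Re z)) (proots (char_poly (mat_adjoint X * X)))))"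

lemma length_singular_values: "length (singular_values X) = dim_col X"
proof -
  have "mat_adjoint X * X \<in> carrier_mat (dim_col X) (dim_col X)"
    by (intro carrier_matI) (auto simp: mat_adjoint_def)
  then have "size (proots (char_poly (mat_adjoint X * X))) = dim_col X"
    using degree_monic_char_poly size_proots_complex by metis
  then show ?thesis
    unfolding singular_values_def
    by (metis length_rev size_mset mset_sorted_list_of_multiset size_image_mset)
qed

(* Only meaningful for matrices with at least two columns. *)
definition smallest_singular_value_nondegenerate :: "complex mat \<Rightarrow> bool" where
  "smallest_singular_value_nondegenerate X \<longleftrightarrow>
     singular_values X ! (dim_col X - 2) > singular_values X ! (dim_col X - 1)"

(* Nodes and weights are indexed from 0: test nodes x 0, ..., x (n - 1), support nodes
   y 0, ..., y (m - 1). *)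
definition modified_cauchy_mat ::
    "nat \<Rightarrow> nat \<Rightarrow> (nat \<Rightarrow> real) \<Rightarrow> (nat \<Rightarrow> real) \<Rightarrow> real mat" where
  "modified_cauchy_mat n m x y =
     mat n m (\<lambda>(k, j).
       if x k \<in> y ` {..<m} then (if x k = y j then 1 else 0) else 1 / (x k - y j))"

definition M_mat ::
    "nat \<Rightarrow> nat \<Rightarrow> (nat \<Rightarrow> real) \<Rightarrow> (nat \<Rightarrow> real) \<Rightarrow> (nat \<Rightarrow> real) \<Rightarrow> real mat" where
  "M_mat n m x y \<mu> = mat_diag n (\<lambda>k. sqrt (\<mu> k)) * modified_cauchy_mat n m x y"

definition S_F_mat :: "nat \<Rightarrow> (nat \<Rightarrow> real) \<Rightarrow> complex mat" where
  "S_F_mat n x = mat_diag n (\<lambda>k. exp (\<i> * complex_of_real (x k)))"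

definition X_mat ::
    "nat \<Rightarrow> nat \<Rightarrow> (nat \<Rightarrow> real) \<Rightarrow> (nat \<Rightarrow> real) \<Rightarrow> (nat \<Rightarrow> real) \<Rightarrow> complex mat" where
  "X_mat n m x y \<mu> =
     (let M = map_mat complex_of_real (M_mat n m x y \<mu>) in hconcat M (- (S_F_mat n x * M)))"

(* The coefficient vector c yields the numerator polynomial p for c = alpha and
   the denominator polynomial q for c = beta. *)
definition bary_poly :: "nat \<Rightarrow> (nat \<Rightarrow> real) \<Rightarrow> complex vec \<Rightarrow> complex poly" where
  "bary_poly m y c =
     (\<Sum>j<m. Polynomial.smult (c $ j) (\<Prod>k\<in>{..<m} - {j}. [:- complex_of_real (y k), 1:]))"

(* The quotient p/q rather than the barycentric formula, so that values at the support
   nodes are the intended ones; see bary_rat_eq_barycentric. *)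
definition bary_rat ::
    "nat \<Rightarrow> (nat \<Rightarrow> real) \<Rightarrow> complex vec \<Rightarrow> complex vec \<Rightarrow> complex \<Rightarrow> complex" where
  "bary_rat m y \<alpha> \<beta> z = poly (bary_poly m y \<alpha>) z / poly (bary_poly m y \<beta>) z"

definition bary_irreducible ::
    "nat \<Rightarrow> (nat \<Rightarrow> real) \<Rightarrow> complex vec \<Rightarrow> complex vec \<Rightarrow> bool" where
  "bary_irreducible m y \<alpha> \<beta> \<longleftrightarrow>
     \<not> (\<exists>z. poly (bary_poly m y \<alpha>) z = 0 \<and> poly (bary_poly m y \<beta>) z = 0)"

definition bary_poles :: "nat \<Rightarrow> (nat \<Rightarrow> real) \<Rightarrow> complex vec \<Rightarrow> complex set" where
  "bary_poles m y \<beta> = {z. poly (bary_poly m y \<beta>) z = 0}"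

lemma poly_bary_poly:
  assumes "z \<notin> complex_of_real ` y ` {..<m}"
  shows "poly (bary_poly m y c) z =
     (\<Prod>k<m. z - complex_of_real (y k)) * (\<Sum>j<m. c $ j / (z - complex_of_real (y j)))"
proof -
  have "c $ j * (\<Prod>k\<in>{..<m} - {j}. z - complex_of_real (y k)) =
      (\<Prod>k<m. z - complex_of_real (y k)) * (c $ j / (z - complex_of_real (y j)))"
    if "j < m" for j
  proof -
    have "z - complex_of_real (y j) \<noteq> 0"
      using assms that by auto
    then show ?thesis
      using prod.remove[of "{..<m}" j "\<lambda>k. z - complex_of_real (y k)"] that by simp
  qed
  then show ?thesis
    by (simp add: bary_poly_def poly_sum poly_prod sum_distrib_left)
qed

lemma bary_rat_eq_barycentric:
  assumes "z \<notin> complex_of_real ` y ` {..<m}"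
  shows "bary_rat m y \<alpha> \<beta> z =
     (\<Sum>j<m. \<alpha> $ j / (z - complex_of_real (y j))) / (\<Sum>j<m. \<beta> $ j / (z - complex_of_real (y j)))"
proof -
  have "(\<Prod>k<m. z - complex_of_real (y k)) \<noteq> 0"
    using assms by auto
  then show ?thesis
    by (simp add: bary_rat_def poly_bary_poly[OF assms])
qed

end

theory Submission
  imports Defs
begin

text \<open>Conjugating and interchanging the two halves of a vector \<open>[\<alpha>; \<beta>]\<close> changes neither its norm nor
  the norm of its image under \<open>X = [M | -S\<^sub>F M]\<close>, because \<open>M\<close> is real and the diagonal entries of \<open>S\<^sub>F\<close>
  lie on the unit circle. Minimizers are eigenvectors of \<open>X\<^sup>* X\<close> for its smallest eigenvalue, which is
  a simple root of the characteristic polynomial by assumption; hence the minimizer is unique up to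
  a phase and \<open>conjugate \<beta> = c \<alpha>\<close> with \<open>|c| = 1\<close>. So \<open>|p| = |q|\<close> on the real axis, where a zero of
  \<open>q\<close> would be a common zero.\<close>

section \<open>Eigenspaces of simple characteristic roots\<close>

text \<open>Back substitution from the last row upwards: in row \<open>i\<close>, entries left of
  the diagonal vanish, and those right of it meet entries of \<open>v\<close> already known to be
  zero. What remains is \<open>B $$ (i, i) * v $ i = \<mu> * v $ i\<close>.\<close>

lemma upper_triangular_eigenvector_entry_zero:
  fixes B :: "'a :: field mat"
  assumes B: "B \<in> carrier_mat n n" and ut: "upper_triangular B"
    and v: "v \<in> carrier_vec n" and eig: "B *\<^sub>v v = \<mu> \<cdot>\<^sub>v v"
    and diag: "\<And>i. k \<le> i \<Longrightarrow> i < n \<Longrightarrow> B $$ (i, i) \<noteq> \<mu>"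
    and "k \<le> i" "i < n"
  shows "v $ i = 0"
  using \<open>k \<le> i\<close> \<open>i < n\<close>
proof (induction "n - i" arbitrary: i rule: less_induct)
  case less
  have "B $$ (i, j) * v $ j = 0" if "j \<noteq> i" "j < n" for j
  proof (cases "j < i")
    case True
    then show ?thesis using ut B less.prems by (auto simp: upper_triangular_def)
  next
    case False
    then have "v $ j = 0" using that less.prems by (intro less.hyps) auto
    then show ?thesis by simp
  qed
  then have "(\<Sum>j\<in>{..<n} - {i}. B $$ (i, j) * v $ j) = 0"
    by (intro sum.neutral) auto
  then have "(\<Sum>j<n. B $$ (i, j) * v $ j) = B $$ (i, i) * v $ i"
    using less.prems by (subst sum.remove[of _ i]) auto
  moreover have "(\<Sum>j<n. B $$ (i, j) * v $ j) = (B *\<^sub>v v) $ i"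
    using B v less.prems by (auto simp: scalar_prod_def atLeast0LessThan)
  ultimately have "B $$ (i, i) * v $ i = \<mu> * v $ i"
    using eig v less.prems by auto
  then show ?case using diag[OF less.prems] by (metis mult_right_cancel)
qed

text \<open>Turns the multiplicity of a root into a number of occurrences in the eigenvalue list
  that \<open>schur_decomposition\<close> takes as input.\<close>

lemma proots_prod_list_linear:
  fixes as :: "'a :: idom list"
  shows "proots (\<Prod>a\<leftarrow>as. [:- a, 1:]) = mset as"
proof (induction as)
  case (Cons a as)
  have "(\<Prod>a\<leftarrow>as. [:- a, 1:]) \<noteq> 0" by (auto simp: prod_list_zero_iff)
  then have "proots ([:- a, 1:] * (\<Prod>a\<leftarrow>as. [:- a, 1:])) =
      proots [:- a, 1:] + proots (\<Prod>a\<leftarrow>as. [:- a, 1:])"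
    by (intro proots_mult) auto
  then show ?case using Cons by simp
qed simp

text \<open>Geometric multiplicity is at most algebraic multiplicity. Triangularization makes this
  available for every square complex matrix, Hermitian or not.\<close>

lemma eigenvectors_proportional:
  fixes A :: "complex mat"
  assumes A: "A \<in> carrier_mat n n"
    and v: "v \<in> carrier_vec n" "v \<noteq> 0\<^sub>v n" "A *\<^sub>v v = \<mu> \<cdot>\<^sub>v v"
    and w: "w \<in> carrier_vec n" "A *\<^sub>v w = \<mu> \<cdot>\<^sub>v w"
    and simple: "count (proots (char_poly A)) \<mu> \<le> 1"
  shows "\<exists>c. w = c \<cdot>\<^sub>v v"
proof -
  from char_poly_factorized[OF A] obtain as
    where as: "char_poly A = (\<Prod>a\<leftarrow>as. [:- a, 1:])" by blast
  have "eigenvalue A \<mu>" using A v by (auto simp: eigenvalue_def eigenvector_def)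
  then have "poly (char_poly A) \<mu> = 0" using eigenvalue_root_char_poly[OF A] by simp
  then have mem: "\<mu> \<in> set as" unfolding as by (auto simp: poly_prod_list prod_list_zero_iff)
  \<comment> \<open>With \<open>\<mu>\<close> placed first on the diagonal of the Schur form, back substitution shows that
    eigenvectors are supported on the first coordinate.\<close>
  define es where "es = remove1 \<mu> as"
  have mset_as: "mset as = mset (\<mu> # es)" using mem by (simp add: es_def)
  then have char: "char_poly A = (\<Prod>a\<leftarrow>\<mu> # es. [:- a, 1:])"
    unfolding as prod_mset_prod_list[symmetric] mset_map by (simp only:)
  then have "count (mset (\<mu> # es)) \<mu> \<le> 1"
    using simple by (simp only: proots_prod_list_linear)
  then have notin: "\<mu> \<notin> set es" by (simp add: count_eq_zero_iff)
  obtain B P Q where BPQ: "schur_decomposition A (\<mu> # es) = (B, P, Q)"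
    by (cases "schur_decomposition A (\<mu> # es)")
  note schur = schur_decomposition[OF A char BPQ]
  then have sim: "similar_mat_wit A B P Q" and ut: "upper_triangular B"
    and diag: "diag_mat B = \<mu> # es" by auto
  note wit = similar_mat_witD2[OF A sim]
  have diag_ne: "B $$ (i, i) \<noteq> \<mu>" if "1 \<le> i" "i < n" for i
  proof -
    have "B $$ (i, i) = diag_mat B ! i" and "length (diag_mat B) = n"
      using that wit by (auto simp: diag_mat_def)
    then have "B $$ (i, i) = es ! (i - 1)" "i - 1 < length es"
      using that diag by auto
    then show ?thesis using notin nth_mem by metis
  qed
  \<comment> \<open>\<open>Q\<close> is the inverse of \<open>P\<close>, so
    \<open>A = P * B * Q\<close> gives \<open>Q * A = B * Q\<close>: eigenvectors of
    \<open>A\<close> become eigenvectors of \<open>B\<close> and are recovered by \<open>P\<close>.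
    The claim is needed for both \<open>v\<close> and \<open>w\<close>.\<close>
  have image: "Q *\<^sub>v u \<in> carrier_vec n \<and> u = P *\<^sub>v (Q *\<^sub>v u) \<and>
      (\<forall>i. 1 \<le> i \<longrightarrow> i < n \<longrightarrow> (Q *\<^sub>v u) $ i = 0)"
    if u: "u \<in> carrier_vec n" "A *\<^sub>v u = \<mu> \<cdot>\<^sub>v u" for u
  proof (intro conjI allI impI)
    show Qu: "Q *\<^sub>v u \<in> carrier_vec n" using wit(7) u by auto
    show "u = P *\<^sub>v (Q *\<^sub>v u)"
      using wit u by (metis assoc_mult_mat_vec one_mult_mat_vec)
    have "Q * (P * B * Q) = B * Q"
      unfolding assoc_mult_mat[OF wit(7) mult_carrier_mat[OF wit(6,5)] wit(7), symmetric]
        assoc_mult_mat[OF wit(7,6,5), symmetric] wit(2) left_mult_one_mat[OF wit(5)] ..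
    then have "Q * A = B * Q" unfolding wit(3)[symmetric] .
    then have "B *\<^sub>v (Q *\<^sub>v u) = Q *\<^sub>v (A *\<^sub>v u)"
      using wit u by (metis assoc_mult_mat_vec)
    then have "B *\<^sub>v (Q *\<^sub>v u) = \<mu> \<cdot>\<^sub>v (Q *\<^sub>v u)"
      using wit u by (simp add: mult_mat_vec)
    then show "(Q *\<^sub>v u) $ i = 0" if "1 \<le> i" "i < n" for i
      using upper_triangular_eigenvector_entry_zero[OF wit(5) ut Qu] diag_ne that by blast
  qed
  define v' w' where "v' = Q *\<^sub>v v" and "w' = Q *\<^sub>v w"
  have v': "v' \<in> carrier_vec n" "v = P *\<^sub>v v'" "\<And>i. 1 \<le> i \<Longrightarrow> i < n \<Longrightarrow> v' $ i = 0"
    using image[OF v(1,3)] by (auto simp: v'_def)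
  have w': "w' \<in> carrier_vec n" "w = P *\<^sub>v w'" "\<And>i. 1 \<le> i \<Longrightarrow> i < n \<Longrightarrow> w' $ i = 0"
    using image[OF w(1,2)] by (auto simp: w'_def)
  have "v' $ 0 \<noteq> 0"
  proof
    assume "v' $ 0 = 0"
    then have "v' $ i = 0" if "i < n" for i using v'(3)[of i] that by (cases "i = 0") auto
    then have "v' = 0\<^sub>v n" using v'(1) by (intro eq_vecI) auto
    then have "v = 0\<^sub>v n" using v'(2) wit(6) by (intro eq_vecI) auto
    with v(2) show False by simp
  qed
  have "w' = (w' $ 0 / v' $ 0) \<cdot>\<^sub>v v'"
  proof (intro eq_vecI)
    fix i assume "i < dim_vec ((w' $ 0 / v' $ 0) \<cdot>\<^sub>v v')"
    then show "w' $ i = ((w' $ 0 / v' $ 0) \<cdot>\<^sub>v v') $ i"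
      using v' w' \<open>v' $ 0 \<noteq> 0\<close> by (cases "i = 0") auto
  qed (use v' w' in auto)
  then have "w = (w' $ 0 / v' $ 0) \<cdot>\<^sub>v v"
    using v'(1,2) w'(2) wit(6) by (metis mult_mat_vec)
  then show ?thesis by blast
qed

section \<open>Adjoints and the Euclidean norm\<close>

lemma adjoint_mult_cscalar_prod:
  fixes X :: "complex mat"
  assumes X: "X \<in> carrier_mat r d" and u: "u \<in> carrier_vec r" and w: "w \<in> carrier_vec d"
  shows "(mat_adjoint X *\<^sub>v u) \<bullet>c w = u \<bullet>c (X *\<^sub>v w)"
proof -
  have "(mat_adjoint X *\<^sub>v u) $ i = (\<Sum>k<r. cnj (X $$ (k, i)) * u $ k)" if "i < d" for i
    using X u that
    by (simp add: mat_adjoint_def scalar_prod_def atLeast0LessThan)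
  moreover have "dim_vec (mat_adjoint X *\<^sub>v u) = d" using X by (simp add: mat_adjoint_def)
  ultimately have "(mat_adjoint X *\<^sub>v u) \<bullet>c w =
      (\<Sum>i<d. \<Sum>k<r. cnj (X $$ (k, i)) * u $ k * cnj (w $ i))"
    using w by (auto simp: scalar_prod_def atLeast0LessThan sum_distrib_right intro!: sum.cong)
  also have "\<dots> = (\<Sum>k<r. \<Sum>i<d. cnj (X $$ (k, i)) * u $ k * cnj (w $ i))"
    by (rule sum.swap)
  also have "\<dots> = u \<bullet>c (X *\<^sub>v w)"
    using X u w
    by (auto simp: scalar_prod_def atLeast0LessThan sum_distrib_left cnj_sum ac_simps
        intro!: sum.cong)
  finally show ?thesis .
qed

lemma l2_norm_power2: "(l2_norm v)\<^sup>2 = (\<Sum>i<dim_vec v. (cmod (v $ i))\<^sup>2)"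
  by (simp add: l2_norm_def sum_nonneg)

lemma l2_norm_square: "complex_of_real ((l2_norm v)\<^sup>2) = v \<bullet>c v"
  by (simp add: l2_norm_def sum_nonneg scalar_prod_def atLeast0LessThan complex_norm_square
      del: of_real_power)

lemma l2_norm_nonneg: "l2_norm v \<ge> 0"
  by (simp add: l2_norm_def sum_nonneg)

lemma l2_norm_smult: "l2_norm (c \<cdot>\<^sub>v v) = cmod c * l2_norm v"
  by (simp add: l2_norm_def norm_mult power_mult_distrib real_sqrt_mult flip: sum_distrib_left)

lemma l2_norm_eq_0_iff: "l2_norm v = 0 \<longleftrightarrow> v = 0\<^sub>v (dim_vec v)"
proof
  assume "l2_norm v = 0"
  then show "v = 0\<^sub>v (dim_vec v)"
    by (intro eq_vecI) (auto simp: l2_norm_def sum_nonneg_eq_0_iff)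
next
  assume "v = 0\<^sub>v (dim_vec v)"
  then have "v $ i = 0" if "i < dim_vec v" for i using that by (metis index_zero_vec(1))
  then show "l2_norm v = 0" by (simp add: l2_norm_def)
qed

text \<open>The expansion along a real line, used to vary a minimizer; as \<open>t\<close> is real,
  only the real part of the inner product enters.\<close>

lemma l2_norm_add_square:
  assumes "dim_vec v = dim_vec w"
  shows "(l2_norm (v + complex_of_real t \<cdot>\<^sub>v w))\<^sup>2 =
    (l2_norm v)\<^sup>2 + 2 * t * Re (v \<bullet>c w) + t\<^sup>2 * (l2_norm w)\<^sup>2"
proof -
  have "(cmod (a + complex_of_real t * b))\<^sup>2 =
      (cmod a)\<^sup>2 + 2 * t * Re (a * cnj b) + t\<^sup>2 * (cmod b)\<^sup>2" for a b
    unfolding cmod_power2 by (simp add: algebra_simps power2_eq_square)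
  then show ?thesis using assms
    by (simp add: l2_norm_power2 scalar_prod_def atLeast0LessThan sum.distrib
        flip: sum_distrib_left)
qed

lemma gram_mult_cscalar_prod:
  fixes X :: "complex mat"
  assumes X: "X \<in> carrier_mat r d" and v: "v \<in> carrier_vec d" and w: "w \<in> carrier_vec d"
  shows "(mat_adjoint X * X *\<^sub>v v) \<bullet>c w = (X *\<^sub>v v) \<bullet>c (X *\<^sub>v w)"
proof -
  have "mat_adjoint X \<in> carrier_mat d r"
    using X by (intro carrier_matI) (auto simp: mat_adjoint_def)
  then show ?thesis
    using adjoint_mult_cscalar_prod[OF X, of "X *\<^sub>v v" w] X v w by simp
qed

section \<open>Minimizers of the norm on the unit sphere\<close>

text \<open>A locale, since the facts about one minimizer are instantiated again for a second one
  when uniqueness is proved.\<close>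

locale norm_minimizer =
  fixes X :: "complex mat" and r d :: nat and g :: "complex vec"
  assumes X: "X \<in> carrier_mat r d"
    and g: "g \<in> carrier_vec d" "l2_norm g = 1"
    and minimal: "\<And>v. v \<in> carrier_vec d \<Longrightarrow> l2_norm v = 1 \<Longrightarrow>
      l2_norm (X *\<^sub>v g) \<le> l2_norm (X *\<^sub>v v)"
begin

lemma gram_carrier: "mat_adjoint X * X \<in> carrier_mat d d"
  using X by (intro carrier_matI) (auto simp: mat_adjoint_def)

text \<open>Homogeneity carries minimality from the unit sphere to all vectors.\<close>

lemma norm_bound:
  assumes v: "v \<in> carrier_vec d"
  shows "l2_norm (X *\<^sub>v g) * l2_norm v \<le> l2_norm (X *\<^sub>v v)"
proof (cases "l2_norm v = 0")
  case True
  then show ?thesis by (simp add: l2_norm_nonneg)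
next
  case False
  then have pos: "l2_norm v > 0" using l2_norm_nonneg[of v] by simp
  define c where "c = complex_of_real (1 / l2_norm v)"
  have c: "cmod c = 1 / l2_norm v" using pos by (simp add: c_def norm_divide)
  have "l2_norm (X *\<^sub>v g) \<le> l2_norm (X *\<^sub>v (c \<cdot>\<^sub>v v))"
    using v pos by (intro minimal) (simp_all add: l2_norm_smult c)
  also have "\<dots> = l2_norm (X *\<^sub>v v) / l2_norm v"
    using mult_mat_vec[OF X v] by (simp add: l2_norm_smult c)
  finally show ?thesis using pos by (simp add: field_simps)
qed

lemma gram_minimizer:
  "mat_adjoint X * X *\<^sub>v g = complex_of_real ((l2_norm (X *\<^sub>v g))\<^sup>2) \<cdot>\<^sub>v g"
proof -
  define l where "l = (l2_norm (X *\<^sub>v g))\<^sup>2"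
  \<comment> \<open>The nonnegative form \<open>|X v|\<^sup>2 - l |v|\<^sup>2\<close> vanishes at \<open>g\<close>, and the residual \<open>w\<close> is half its
    gradient there; moving in the direction \<open>- w\<close> would make it negative.\<close>
  define w where "w = mat_adjoint X * X *\<^sub>v g - complex_of_real l \<cdot>\<^sub>v g"
  have Ag: "mat_adjoint X * X *\<^sub>v g \<in> carrier_vec d" using gram_carrier g by auto
  have w: "w \<in> carrier_vec d" using Ag g by (simp add: w_def)
  have Xc: "X *\<^sub>v g \<in> carrier_vec r" "X *\<^sub>v w \<in> carrier_vec r" using X g w by auto
  have "w \<bullet>c w = (X *\<^sub>v g) \<bullet>c (X *\<^sub>v w) - complex_of_real l * (g \<bullet>c w)"
    using gram_mult_cscalar_prod[OF X g(1) w] Ag g w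
    by (subst (1) w_def) (simp add: minus_scalar_prod_distrib)
  \<comment> \<open>The left side is half the derivative of the form at \<open>g\<close> in
    direction \<open>w\<close>; it equals the squared norm of \<open>w\<close> because
    \<open>w\<close> is half the gradient.\<close>
  then have cross: "Re ((X *\<^sub>v g) \<bullet>c (X *\<^sub>v w)) - l * Re (g \<bullet>c w) = (l2_norm w)\<^sup>2"
    unfolding l2_norm_square[symmetric]
    by (metis Re_complex_of_real minus_complex.simps(1) times_complex.simps(1) Im_complex_of_real
        mult_zero_left diff_zero)
  define s where "s = (l2_norm (X *\<^sub>v w))\<^sup>2 - l * (l2_norm w)\<^sup>2"
  \<comment> \<open>The form at \<open>g + t w\<close>: its constant term vanishes since
    \<open>g\<close> has norm 1, \<open>cross\<close> gives the linear term, and \<open>s\<close> is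
    its value at \<open>w\<close>, of unknown sign.\<close>
  have quad: "0 \<le> 2 * t * (l2_norm w)\<^sup>2 + t\<^sup>2 * s" for t
  proof -
    have "l * (l2_norm (g + complex_of_real t \<cdot>\<^sub>v w))\<^sup>2 \<le>
        (l2_norm (X *\<^sub>v (g + complex_of_real t \<cdot>\<^sub>v w)))\<^sup>2"
      using norm_bound[of "g + complex_of_real t \<cdot>\<^sub>v w"] g w l2_norm_nonneg
      by (auto simp: l_def power_mono simp flip: power_mult_distrib)
    also have "X *\<^sub>v (g + complex_of_real t \<cdot>\<^sub>v w) = X *\<^sub>v g + complex_of_real t \<cdot>\<^sub>v (X *\<^sub>v w)"
      using X g w by (simp add: mult_add_distrib_mat_vec mult_mat_vec)
    finally have "l * (1 + 2 * t * Re (g \<bullet>c w) + t\<^sup>2 * (l2_norm w)\<^sup>2) \<le>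
        l + 2 * t * Re ((X *\<^sub>v g) \<bullet>c (X *\<^sub>v w)) + t\<^sup>2 * (l2_norm (X *\<^sub>v w))\<^sup>2"
      using g w Xc by (simp add: l2_norm_add_square l_def)
    then show ?thesis
      unfolding s_def cross[symmetric] by (simp add: algebra_simps)
  qed
  have "(l2_norm w)\<^sup>2 = 0"
  proof (rule ccontr)
    assume "(l2_norm w)\<^sup>2 \<noteq> 0"
    then have pos: "(l2_norm w)\<^sup>2 > 0" by simp
    \<comment> \<open>Small enough that the quadratic term cannot outweigh the linear one, whatever
      the sign of \<open>s\<close>; the summand 1 keeps the denominator positive when
      \<open>s = 0\<close>.\<close>
    define t where "t = - (l2_norm w)\<^sup>2 / (\<bar>s\<bar> + 1)"
    have "t < 0" using pos by (simp add: t_def divide_neg_pos)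
    have "\<bar>t * s\<bar> \<le> (l2_norm w)\<^sup>2"
      by (simp add: t_def abs_mult divide_le_eq mult_left_mono)
    then have "2 * (l2_norm w)\<^sup>2 + t * s > 0" using pos by linarith
    then have "t * (2 * (l2_norm w)\<^sup>2 + t * s) < 0" using \<open>t < 0\<close> mult_neg_pos by blast
    then show False using quad[of t] by (simp add: algebra_simps power2_eq_square)
  qed
  then have "w = 0\<^sub>v d" using w l2_norm_eq_0_iff[of w] by simp
  show ?thesis
  proof (intro eq_vecI)
    fix i assume "i < dim_vec (complex_of_real ((l2_norm (X *\<^sub>v g))\<^sup>2) \<cdot>\<^sub>v g)"
    then have i: "i < d" using g by simp
    then have "w $ i = (mat_adjoint X * X *\<^sub>v g) $ i - complex_of_real l * g $ i"
      using Ag g by (simp add: w_def del: index_mult_mat_vec)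
    then show "(mat_adjoint X * X *\<^sub>v g) $ i = (complex_of_real ((l2_norm (X *\<^sub>v g))\<^sup>2) \<cdot>\<^sub>v g) $ i"
      using \<open>w = 0\<^sub>v d\<close> i g by (simp add: l_def del: index_mult_mat_vec)
  qed (simp only: carrier_vecD[OF Ag] index_smult_vec carrier_vecD[OF g(1)])
qed

text \<open>For an eigenvector \<open>v\<close> with eigenvalue \<open>z\<close>, pairing with
  \<open>v\<close> gives \<open>|X v|\<^sup>2 = z |v|\<^sup>2\<close>, and \<open>norm_bound\<close>
  applies. Hence the eigenvalue belonging to \<open>g\<close> is the least one.\<close>

lemma gram_root_ge:
  assumes "z \<in># proots (char_poly (mat_adjoint X * X))"
  shows "(l2_norm (X *\<^sub>v g))\<^sup>2 \<le> Re z"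
proof -
  have "char_poly (mat_adjoint X * X) \<noteq> 0"
    using degree_monic_char_poly[OF gram_carrier] by auto
  then have "eigenvalue (mat_adjoint X * X) z"
    using assms eigenvalue_root_char_poly[OF gram_carrier] by simp
  then obtain v where v: "v \<in> carrier_vec d" "v \<noteq> 0\<^sub>v d" "mat_adjoint X * X *\<^sub>v v = z \<cdot>\<^sub>v v"
    using gram_carrier unfolding eigenvalue_def eigenvector_def by auto
  have pos: "(l2_norm v)\<^sup>2 > 0" using v l2_norm_eq_0_iff[of v] by simp
  have "complex_of_real ((l2_norm (X *\<^sub>v v))\<^sup>2) = z * complex_of_real ((l2_norm v)\<^sup>2)"
    unfolding l2_norm_square gram_mult_cscalar_prod[OF X v(1) v(1), symmetric] v(3)
    using v(1) by simp
  then have "(l2_norm (X *\<^sub>v v))\<^sup>2 = Re z * (l2_norm v)\<^sup>2"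
    by (metis Re_complex_of_real times_complex.simps(1) Im_complex_of_real mult_zero_right diff_zero)
  moreover have "(l2_norm (X *\<^sub>v g))\<^sup>2 * (l2_norm v)\<^sup>2 \<le> (l2_norm (X *\<^sub>v v))\<^sup>2"
    using norm_bound[OF v(1)] l2_norm_nonneg
    by (simp add: power_mono flip: power_mult_distrib)
  ultimately show ?thesis using pos by simp
qed

end

section \<open>Simplicity of the least eigenvalue and uniqueness of the minimizer\<close>

text \<open>Prefixing two copies of \<open>s\<close> to the sorted remainder yields a sorted list
  with multiset \<open>M\<close>, and such a list is unique.\<close>

lemma sorted_list_of_multiset_min_repeated:
  fixes M :: "'a :: linorder multiset"
  assumes min: "\<And>z. z \<in># M \<Longrightarrow> s \<le> z" and count: "count M s \<ge> 2"
  shows "sorted_list_of_multiset M ! 0 = s" "sorted_list_of_multiset M ! 1 = s"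
proof -
  define N where "N = M - {#s, s#}"
  have M: "M = {#s, s#} + N"
    using count by (intro multiset_eqI) (auto simp: N_def)
  have "\<And>z. z \<in># N \<Longrightarrow> s \<le> z" using min M by simp
  then have "sorted (s # s # sorted_list_of_multiset N)" by simp
  moreover have "M = mset (s # s # sorted_list_of_multiset N)" by (simp add: M)
  ultimately have "sorted_list_of_multiset M = s # s # sorted_list_of_multiset N"
    by (metis sorted_list_of_multiset_mset sorted_sort_id)
  then show "sorted_list_of_multiset M ! 0 = s" "sorted_list_of_multiset M ! 1 = s" by auto
qed

text \<open>A double root at the least eigenvalue would make the last two singular values
  equal.\<close>

lemma (in norm_minimizer) smallest_singular_value_simple:
  assumes "smallest_singular_value_nondegenerate X" "d \<ge> 2"
  shows "count (proots (char_poly (mat_adjoint X * X)))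
    (complex_of_real ((l2_norm (X *\<^sub>v g))\<^sup>2)) \<le> 1"
proof (rule ccontr)
  define l where "l = complex_of_real ((l2_norm (X *\<^sub>v g))\<^sup>2)"
  define R where "R = proots (char_poly (mat_adjoint X * X))"
  define S where "S = image_mset (\<lambda>z. sqrt (Re z)) R"
  assume "\<not> ?thesis"
  then have "count R l \<ge> 2" by (simp add: l_def R_def)
  then have "replicate_mset 2 l \<subseteq># R" by (simp add: count_le_replicate_mset_subset_eq)
  \<comment> \<open>Taking images may merge elements but never lowers a multiplicity.\<close>
  then have "replicate_mset 2 (sqrt (Re l)) \<subseteq># S"
    unfolding S_def using image_mset_subseteq_mono by fastforce
  then have "count S (sqrt (Re l)) \<ge> 2" by (simp add: count_le_replicate_mset_subset_eq)
  moreover have "sqrt (Re l) \<le> z" if "z \<in># S" for z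
  proof -
    from that obtain u where u: "u \<in># R" "z = sqrt (Re u)" unfolding S_def by auto
    then have "Re l \<le> Re u"
      using gram_root_ge unfolding R_def l_def Re_complex_of_real by blast
    then show ?thesis unfolding u(2) by simp
  qed
  ultimately have eq: "sorted_list_of_multiset S ! 0 = sqrt (Re l)"
      "sorted_list_of_multiset S ! 1 = sqrt (Re l)"
    using sorted_list_of_multiset_min_repeated by blast+
  have sv: "singular_values X = rev (sorted_list_of_multiset S)"
    by (simp add: singular_values_def S_def R_def)
  have "length (sorted_list_of_multiset S) = d"
    using length_singular_values[of X] X by (simp add: sv)
  \<comment> \<open>Reversal sends positions 0 and 1 of the increasing list to positions
    \<open>d - 1\<close> and \<open>d - 2\<close>.\<close>
  then have "singular_values X ! (d - 1) = sqrt (Re l)" "singular_values X ! (d - 2) = sqrt (Re l)"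
    using \<open>d \<ge> 2\<close> eq by (auto simp: sv rev_nth numeral_2_eq_2 Suc_diff_Suc)
  then show False
    using assms X by (simp add: smallest_singular_value_nondegenerate_def)
qed

text \<open>\<open>v\<close> attains the same minimum, so both vectors are eigenvectors of
  \<open>X\<^sup>* X\<close> for the same simple eigenvalue; equal norms force the factor onto the
  unit circle.\<close>

lemma (in norm_minimizer) minimizer_unique:
  assumes "smallest_singular_value_nondegenerate X" "d \<ge> 2"
    and v: "v \<in> carrier_vec d" "l2_norm v = 1" "l2_norm (X *\<^sub>v v) = l2_norm (X *\<^sub>v g)"
  shows "\<exists>c. cmod c = 1 \<and> v = c \<cdot>\<^sub>v g"
proof -
  interpret v: norm_minimizer X r d v
    using X v minimal by unfold_locales auto
  have "g \<noteq> 0\<^sub>v d" using g l2_norm_eq_0_iff[of g] by auto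
  then obtain c where c: "v = c \<cdot>\<^sub>v g"
    using eigenvectors_proportional[OF gram_carrier g(1) _ gram_minimizer v(1)
        v.gram_minimizer[unfolded v(3)] smallest_singular_value_simple[OF assms(1,2)]] by blast
  then have "cmod c = 1" using v g by (simp add: l2_norm_smult)
  with c show ?thesis by blast
qed

section \<open>The matrix \<open>X\<close> and its conjugation symmetry\<close>

lemma M_mat_carrier: "M_mat n m x y \<mu> \<in> carrier_mat n m"
  unfolding M_mat_def
  by (rule mult_carrier_mat[OF mat_diag_dim]) (simp add: modified_cauchy_mat_def)

lemma X_mat_carrier: "X_mat n m x y \<mu> \<in> carrier_mat n (2 * m)"
proof -
  define M where "M = map_mat complex_of_real (M_mat n m x y \<mu>)"
  have M: "M \<in> carrier_mat n m" using M_mat_carrier by (simp add: M_def)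
  have "four_block_mat M (- (S_F_mat n x * M)) (0\<^sub>m 0 (dim_col M)) (0\<^sub>m 0 (dim_col (- (S_F_mat n x * M))))
      \<in> carrier_mat (n + 0) (m + m)"
    using M by (intro four_block_carrier_mat) auto
  then show ?thesis by (simp add: X_mat_def Let_def hconcat_def M_def mult_2)
qed

text \<open>At a test node that is no support node, this is the weighted linearized error: numerator
  sum minus the exponential times the denominator sum.\<close>

lemma X_mat_mult_index:
  assumes "\<alpha> \<in> carrier_vec m" "\<beta> \<in> carrier_vec m" "k < n"
  shows "(X_mat n m x y \<mu> *\<^sub>v (\<alpha> @\<^sub>v \<beta>)) $ k =
    (\<Sum>j<m. complex_of_real (M_mat n m x y \<mu> $$ (k, j)) * \<alpha> $ j) -
    exp (\<i> * complex_of_real (x k)) *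
      (\<Sum>j<m. complex_of_real (M_mat n m x y \<mu> $$ (k, j)) * \<beta> $ j)"
proof -
  define M where "M = map_mat complex_of_real (M_mat n m x y \<mu>)"
  have M: "M \<in> carrier_mat n m"
    using M_mat_carrier by (simp add: M_def)
  have SM: "S_F_mat n x * M \<in> carrier_mat n m"
    unfolding S_F_mat_def by (rule mult_carrier_mat[OF mat_diag_dim M])
  have dim: "dim_row (S_F_mat n x) = n"
    unfolding S_F_mat_def by (rule carrier_matD(1)[OF mat_diag_dim])
  have entry: "(S_F_mat n x * M) $$ (k, j) = exp (\<i> * complex_of_real (x k)) * M $$ (k, j)"
    if "j < m" for j
    using M that assms by (simp add: S_F_mat_def mat_diag_mult_left[OF M])
  \<comment> \<open>\<open>hconcat\<close> is a block matrix whose lower blocks have no rows, so the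
    appended second vector is empty.\<close>
  have "(X_mat n m x y \<mu> *\<^sub>v (\<alpha> @\<^sub>v \<beta>)) =
      (M *\<^sub>v \<alpha> + (- (S_F_mat n x * M)) *\<^sub>v \<beta>) @\<^sub>v (0\<^sub>m 0 m *\<^sub>v \<alpha> + 0\<^sub>m 0 m *\<^sub>v \<beta>)"
    unfolding X_mat_def Let_def M_def[symmetric] hconcat_def
    using four_block_mat_mult_vec[OF M, of "- (S_F_mat n x * M)" m "0\<^sub>m 0 m" 0 "0\<^sub>m 0 m" \<alpha> \<beta>]
      M SM assms by simp
  also have "\<dots> $ k = (M *\<^sub>v \<alpha>) $ k + ((- (S_F_mat n x * M)) *\<^sub>v \<beta>) $ k"
    using M SM assms by (simp add: dim)
  also have "\<dots> = (\<Sum>j<m. M $$ (k, j) * \<alpha> $ j) -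
      exp (\<i> * complex_of_real (x k)) * (\<Sum>j<m. M $$ (k, j) * \<beta> $ j)"
    using M SM assms entry
    by (simp add: scalar_prod_def atLeast0LessThan sum_negf sum_distrib_left mult.assoc dim)
  finally show ?thesis
    using M assms by (simp add: M_def)
qed

text \<open>Each entry \<open>a - e * b\<close> turns into
  \<open>cnj b - e * cnj a = - e * cnj (a - e * b)\<close>, because \<open>e * cnj e = 1\<close>;
  the moduli agree row by row.\<close>

lemma l2_norm_X_mat_swap_conjugate:
  assumes \<alpha>: "\<alpha> \<in> carrier_vec m" and \<beta>: "\<beta> \<in> carrier_vec m"
  shows "l2_norm (X_mat n m x y \<mu> *\<^sub>v (conjugate \<beta> @\<^sub>v conjugate \<alpha>)) =
    l2_norm (X_mat n m x y \<mu> *\<^sub>v (\<alpha> @\<^sub>v \<beta>))"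
proof -
  have "cmod ((X_mat n m x y \<mu> *\<^sub>v (conjugate \<beta> @\<^sub>v conjugate \<alpha>)) $ k) =
      cmod ((X_mat n m x y \<mu> *\<^sub>v (\<alpha> @\<^sub>v \<beta>)) $ k)" if k: "k < n" for k
  proof -
    define e where "e = exp (\<i> * complex_of_real (x k))"
    define a b where "a = (\<Sum>j<m. complex_of_real (M_mat n m x y \<mu> $$ (k, j)) * \<alpha> $ j)"
      and "b = (\<Sum>j<m. complex_of_real (M_mat n m x y \<mu> $$ (k, j)) * \<beta> $ j)"
    have conj: "(\<Sum>j<m. complex_of_real (M_mat n m x y \<mu> $$ (k, j)) * conjugate v $ j) =
        cnj (\<Sum>j<m. complex_of_real (M_mat n m x y \<mu> $$ (k, j)) * v $ j)"
      if "v \<in> carrier_vec m" for v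
      using that by (simp add: cnj_sum)
    have "cmod e = 1" by (simp add: e_def)
    then have "e * cnj e = 1" by (simp flip: complex_norm_square)
    then have "cnj b - e * cnj a = - e * cnj (a - e * b)"
      by (simp add: algebra_simps flip: mult.assoc)
    then have "cmod (cnj b - e * cnj a) = cmod (a - e * b)"
      using \<open>cmod e = 1\<close> by (simp only: norm_mult norm_minus_cancel complex_mod_cnj)
    then show ?thesis
      using X_mat_mult_index[OF \<alpha> \<beta> k, of x y \<mu>]
        X_mat_mult_index[of "conjugate \<beta>" m "conjugate \<alpha>" k n x y \<mu>] \<alpha> \<beta> k
      by (simp only: conj a_def b_def e_def carrier_vec_conjugate)
  qed
  then show ?thesis using X_mat_carrier[of n m x y \<mu>]
    by (simp add: l2_norm_def)
qed

lemma l2_norm_swap_conjugate: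
  "l2_norm (conjugate \<beta> @\<^sub>v conjugate \<alpha>) = l2_norm (\<alpha> @\<^sub>v \<beta>)"
proof -
  have split: "(l2_norm (u @\<^sub>v v))\<^sup>2 = (l2_norm u)\<^sup>2 + (l2_norm v)\<^sup>2" for u v
  proof -
    have app: "conjugate (u @\<^sub>v v) = conjugate u @\<^sub>v conjugate v"
      by (intro eq_vecI) auto
    have "complex_of_real ((l2_norm (u @\<^sub>v v))\<^sup>2) = complex_of_real ((l2_norm u)\<^sup>2 + (l2_norm v)\<^sup>2)"
      unfolding of_real_add l2_norm_square app
      by (rule scalar_prod_append[of u "dim_vec u" v "dim_vec v"]) (auto intro: carrier_vecI)
    then show ?thesis using of_real_eq_iff by blast
  qed
  have conj: "l2_norm (conjugate u) = l2_norm u" for u by (simp add: l2_norm_def)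
  have "(l2_norm (conjugate \<beta> @\<^sub>v conjugate \<alpha>))\<^sup>2 = (l2_norm (\<alpha> @\<^sub>v \<beta>))\<^sup>2"
    by (simp add: split conj)
  then show ?thesis by (simp add: l2_norm_nonneg)
qed

section \<open>Unit modulus on the real axis\<close>

text \<open>The nodes and the argument are real, so conjugation acts on the coefficients
  only.\<close>

lemma poly_bary_poly_conjugate:
  assumes "c \<in> carrier_vec m"
  shows "poly (bary_poly m y (conjugate c)) (complex_of_real t) =
    cnj (poly (bary_poly m y c) (complex_of_real t))"
  using assms by (simp add: bary_poly_def poly_sum poly_prod cnj_sum cnj_prod)

lemma poly_bary_poly_smult:
  assumes "c \<in> carrier_vec m"
  shows "poly (bary_poly m y (a \<cdot>\<^sub>v c)) z = a * poly (bary_poly m y c) z"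
  using assms by (simp add: bary_poly_def poly_sum sum_distrib_left mult.assoc)

theorem proposition5:
  fixes m n :: nat
    and x y \<mu> :: "nat \<Rightarrow> real"
    and \<alpha> \<beta> \<gamma> :: "complex vec"
  assumes "m \<ge> 1"
    and "n > m - 1"
    and "inj_on y {..<m}"
    and "inj_on x {..<n}"
    and "\<And>k. k < n \<Longrightarrow> \<mu> k > 0"
    and "smallest_singular_value_nondegenerate (X_mat n m x y \<mu>)"
    and "\<alpha> \<in> carrier_vec m"
    and "\<beta> \<in> carrier_vec m"
    and "\<gamma> = \<alpha> @\<^sub>v \<beta>"
    and "l2_norm \<gamma> = 1"
    and "\<And>v. v \<in> carrier_vec (2 * m) \<Longrightarrow> l2_norm v = 1 \<Longrightarrow>
           l2_norm (X_mat n m x y \<mu> *\<^sub>v \<gamma>) \<le> l2_norm (X_mat n m x y \<mu> *\<^sub>v v)"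
    and "bary_irreducible m y \<alpha> \<beta>"
  shows "(\<forall>t :: real. complex_of_real t \<notin> bary_poles m y \<beta>) \<and>
         (\<forall>t :: real. cmod (bary_rat m y \<alpha> \<beta> (complex_of_real t)) = 1)"
proof -
  define X where "X = X_mat n m x y \<mu>"
  have \<gamma>: "\<gamma> \<in> carrier_vec (2 * m)" using assms(7-9) by (simp add: mult_2)
  interpret norm_minimizer X n "2 * m" \<gamma>
    using X_mat_carrier \<gamma> assms(10,11) by unfold_locales (auto simp: X_def)
  have swap: "conjugate \<beta> @\<^sub>v conjugate \<alpha> \<in> carrier_vec (2 * m)"
    using assms(7,8) by (simp add: mult_2)
  \<comment> \<open>The swapped conjugate of \<gamma> is again a minimizer; \<open>m \<ge> 1\<close>
    supplies the dimension bound \<open>2 * m \<ge> 2\<close>.\<close>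
  obtain c where c: "cmod c = 1" "conjugate \<beta> @\<^sub>v conjugate \<alpha> = c \<cdot>\<^sub>v \<gamma>"
    using minimizer_unique[OF _ _ swap] assms l2_norm_swap_conjugate[of \<beta> \<alpha>]
      l2_norm_X_mat_swap_conjugate[OF assms(7,8), of n x y \<mu>]
    by (auto simp: X_def)
  have "conjugate \<beta> = c \<cdot>\<^sub>v \<alpha>"
  proof (intro eq_vecI)
    fix i assume "i < dim_vec (c \<cdot>\<^sub>v \<alpha>)"
    then have i: "i < m" using assms(7) by simp
    then have "(conjugate \<beta> @\<^sub>v conjugate \<alpha>) $ i = (c \<cdot>\<^sub>v (\<alpha> @\<^sub>v \<beta>)) $ i"
      using c(2) assms(9) by simp
    then show "conjugate \<beta> $ i = (c \<cdot>\<^sub>v \<alpha>) $ i" using i assms(7,8) by simp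
  qed (use assms(7,8) in simp)
  \<comment> \<open>In terms of \<open>p\<close> and \<open>q\<close>: the conjugate of
    \<open>q\<close> is \<open>c p\<close> at every real point.\<close>
  then have "cnj (poly (bary_poly m y \<beta>) (complex_of_real t)) =
      c * poly (bary_poly m y \<alpha>) (complex_of_real t)" for t
    using assms(7,8) by (metis poly_bary_poly_conjugate poly_bary_poly_smult)
  then have eq: "cmod (poly (bary_poly m y \<beta>) (complex_of_real t)) =
      cmod (poly (bary_poly m y \<alpha>) (complex_of_real t))" for t
    using c(1) by (metis complex_mod_cnj norm_mult mult_1)
  have "poly (bary_poly m y \<beta>) (complex_of_real t) \<noteq> 0" for t
    using eq[of t] assms(12) unfolding bary_irreducible_def by (metis norm_eq_zero)
  then show ?thesis
    using eq by (simp add: bary_poles_def bary_rat_def norm_divide flip: eq)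
qed

end
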